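(* Let $X,Y$ be Banach spaces, let $A:D(A)\subseteq X\to Y$ be a closed, possibly nonlinear, injective map, let $g\in\mathcal R(A)$, and let $u$ be the unique solution of $A(u)=g$. Let $\phi:D(\phi)\to[0,\infty)$ be a functional with $D(\phi)\subseteq D(A)$ and $\phi(v)>0$ if $v\neq 0$, such that for every $c>0$ the set $\mathcal K_c:=\{v\in D(\phi):\phi(v)\le c\}$ is compact in $X$, and such that $\phi(v)\le\liminf_{n\to\infty}\phi(v_n)$ whenever $v_n\in\mathcal K_c$ and $v_n\to v$ in $X$. Assume $u\in D(\phi)$ and fix a constant $c>0$ with $\phi(u)\le c$. For each $\delta>0$ let $g_\delta\in Y$ be given with $\|g_\delta-g\|\le\delta$, and let $R(\delta)g_\delta:=v_\delta$, where $v_\delta$ is the limit in $X$ of a convergent (sub)sequence of a minimizing sequence for the functional $F_\delta(v):=\|A(v)-g_\delta\|+\delta\phi(v)$ on the set $S_\delta:=\{v\in D(\phi):\|A(v)-g_\delta\|\le\delta,\ \phi(v)\le c\}$, as described in the context. Then $R(\delta)$ is a regularizer for the problem $A(u)=g$ in the new sense, that is, $$\sup_{v\in S_\delta}\|R(\delta)g_\delta-v\|\le\eta(\delta)\quad\text{for some function }\eta\text{ with }\eta(\delta)\to 0\text{ as }\delta\to 0.$$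
   Context: $\mathcal R(A)$ denotes the range of $A$, and $D(\cdot)$ denotes domain. The map $A$ is closed if $v_n\in D(A)$, $v_n\to v$ in $X$ and $A(v_n)\to f$ in $Y$ imply $v\in D(A)$ and $A(v)=f$. Regularizer in the new sense: given a compact set $\mathcal K\subset X$ (here $\mathcal K=\mathcal K_c$) and data $g_\delta$ with $\|g_\delta-g\|\le\delta$, set $S_\delta:=\{v\in\mathcal K:\|A(v)-g_\delta\|\le\delta\}$. A family of operators $R(\delta)$ is a regularizer for $A(u)=g$ in the new sense if $\sup_{v\in S_\delta}\|R(\delta)g_\delta-v\|\le\eta(\delta)\to0$ as $\delta\to0$. Construction of $v_\delta$: let $m(\delta):=\inf_{v\in S_\delta}F_\delta(v)$. A minimizing sequence is a sequence $v_j\in S_\delta$ with $F_\delta(v_j)\to m(\delta)$, chosen so that $F_\delta(v_j)\le 2m(\delta)$ for all $j$. Since $v_j\in\mathcal K_c$ and $\mathcal K_c$ is compact in $X$, after passing to a subsequence $v_j\to v_\delta$ in $X$; for each $\delta$ one such limit $v_\delta$ is chosen, and $R(\delta)g_\delta:=v_\delta$. *)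

theory Defs
  imports "HOL-Analysis.Analysis"
begin

text \<open>A partial map \<open>A : D(A) \<subseteq> X \<rightarrow> Y\<close> is a total function \<open>A\<close> together with its domain \<open>D\<close>; the values
  of \<open>A\<close> outside \<open>D\<close> are never used. The same convention applies to the functional \<open>\<phi>\<close>.\<close>

definition closed_operator ::
    "'x::real_normed_vector set \<Rightarrow> ('x \<Rightarrow> 'y::real_normed_vector) \<Rightarrow> bool" where
  "closed_operator D A \<longleftrightarrow>
    (\<forall>w v f. (\<forall>n. w n \<in> D) \<and> w \<longlonglongrightarrow> v \<and> (\<lambda>n. A (w n)) \<longlonglongrightarrow> f \<longrightarrow> v \<in> D \<and> A v = f)"

definition sublevel_set :: "'x set \<Rightarrow> ('x \<Rightarrow> real) \<Rightarrow> real \<Rightarrow> 'x set" where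
  "sublevel_set D \<phi> c = {v \<in> D. \<phi> v \<le> c}"

text \<open>The set \<open>S\<^sub>\<delta>\<close> for the data \<open>h = g\<^sub>\<delta>\<close>; \<open>K\<close> is meant to be contained in the domain of \<open>A\<close>.\<close>

definition admissible_set ::
    "('x \<Rightarrow> 'y::real_normed_vector) \<Rightarrow> 'x set \<Rightarrow> real \<Rightarrow> 'y \<Rightarrow> 'x set" where
  "admissible_set A K \<delta> h = {v \<in> K. norm (A v - h) \<le> \<delta>}"

text \<open>\<open>R\<close> is a regularizer in the new sense, for a given family of data \<open>gd \<delta>\<close> and a given compact
  set \<open>K\<close>. The supremum is taken in the extended reals, so that the bound by \<open>\<eta> \<delta>\<close> also
  asserts that it is finite from above (for a supremum in \<open>real\<close> it would be meaningless on an unbounded set).\<close>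

definition regularizer_new_sense ::
    "('x::real_normed_vector \<Rightarrow> 'y::real_normed_vector) \<Rightarrow> 'x set \<Rightarrow> (real \<Rightarrow> 'y) \<Rightarrow>
      (real \<Rightarrow> 'y \<Rightarrow> 'x) \<Rightarrow> bool" where
  "regularizer_new_sense A K gd R \<longleftrightarrow>
    (\<exists>\<eta> :: real \<Rightarrow> real. (\<eta> \<longlongrightarrow> 0) (at_right 0) \<and>
      (\<forall>\<delta>>0. (SUP v\<in>admissible_set A K \<delta> (gd \<delta>). ereal (norm (R \<delta> (gd \<delta>) - v))) \<le> ereal (\<eta> \<delta>)))"

definition penalized_functional ::
    "('x \<Rightarrow> 'y::real_normed_vector) \<Rightarrow> ('x \<Rightarrow> real) \<Rightarrow> real \<Rightarrow> 'y \<Rightarrow> 'x \<Rightarrow> real" where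
  "penalized_functional A \<phi> \<delta> h v = norm (A v - h) + \<delta> * \<phi> v"

text \<open>The infimum is a genuine one whenever \<open>S\<close> is nonempty and \<open>F\<close> is bounded below on \<open>S\<close>.\<close>

definition minimizing_sequence :: "('x \<Rightarrow> real) \<Rightarrow> 'x set \<Rightarrow> (nat \<Rightarrow> 'x) \<Rightarrow> bool" where
  "minimizing_sequence F S w \<longleftrightarrow>
    (\<forall>j. w j \<in> S) \<and> (\<lambda>j. F (w j)) \<longlonglongrightarrow> (INF v\<in>S. F v) \<and>
    (\<forall>j. F (w j) \<le> 2 * (INF v\<in>S. F v))"

definition minimizing_limit ::
    "('x::topological_space \<Rightarrow> real) \<Rightarrow> 'x set \<Rightarrow> 'x \<Rightarrow> bool" where
  "minimizing_limit F S v \<longleftrightarrow>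
    (\<exists>w r. minimizing_sequence F S w \<and> strict_mono (r :: nat \<Rightarrow> nat) \<and> (w \<circ> r) \<longlonglongrightarrow> v)"

end

theory Submission
  imports Defs
begin

text \<open>The convergence comes from Tikhonov's observation that an injective closed map has a continuous
  inverse on the image of a compact set. Every
  \<open>v \<in> S\<^sub>\<delta>\<close> lies in the compact set \<open>K\<^sub>c\<close> and satisfies \<open>\<parallel>A v - A u\<parallel> \<le> 2\<delta>\<close>, so
  \<open>\<rho>(\<delta>) = sup {\<parallel>v - u\<parallel> | v \<in> S\<^sub>\<delta>}\<close> tends to \<open>0\<close> with \<open>\<delta>\<close>
  (\<open>inverse_of_closed_injective_continuous_at\<close>).

  The map \<open>A\<close> need not be continuous, so \<open>S\<^sub>\<delta>\<close> need not be closed, and the chosen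
  point \<open>v\<^sub>\<delta>\<close> may lie outside it. It is however a limit of points of \<open>S\<^sub>\<delta>\<close>, and the
  inequality \<open>\<parallel>v - u\<parallel> \<le> \<rho>(\<delta>)\<close> passes to limits. Hence
  \<open>\<parallel>v\<^sub>\<delta> - v\<parallel> \<le> \<parallel>v\<^sub>\<delta> - u\<parallel> + \<parallel>v - u\<parallel> \<le> 2\<rho>(\<delta>)\<close> for all \<open>v \<in> S\<^sub>\<delta>\<close>.\<close>

text \<open>If a tolerance \<open>e\<close> failed for every \<open>d\<close>, compactness would extract from the violating points a
  limit at distance at least \<open>e\<close> from \<open>u\<close>, while closedness and injectivity force that limit to be
  \<open>u\<close>.\<close>

lemma inverse_of_closed_injective_continuous_at:
  fixes A :: "'x::real_normed_vector \<Rightarrow> 'y::real_normed_vector"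
  assumes closed: "closed_operator D A" and inj: "inj_on A D"
    and K: "compact K" "K \<subseteq> D" and u: "u \<in> D" and e: "0 < e"
  obtains d where "0 < d" "\<And>v. v \<in> K \<Longrightarrow> norm (A v - A u) \<le> d \<Longrightarrow> norm (v - u) < e"
proof -
  have "\<exists>d>0. \<forall>v\<in>K. norm (A v - A u) \<le> d \<longrightarrow> norm (v - u) < e"
  proof (rule ccontr)
    assume contra: "\<not> ?thesis"
    have "\<exists>v\<in>K. norm (A v - A u) \<le> inverse (real (Suc n)) \<and> e \<le> norm (v - u)" for n
    proof -
      have "0 < inverse (real (Suc n))" by simp
      then show ?thesis using contra not_less by blast
    qed
    then obtain w where w: "\<And>n. w n \<in> K"
      and Aw: "\<And>n. norm (A (w n) - A u) \<le> inverse (real (Suc n))"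
      and far: "\<And>n. e \<le> norm (w n - u)" by metis
    obtain l r where r: "strict_mono (r :: nat \<Rightarrow> nat)" and l: "(w \<circ> r) \<longlonglongrightarrow> l"
      using K(1) w unfolding compact_def by metis
    have "(\<lambda>n. A (w n) - A u) \<longlonglongrightarrow> 0"
      by (rule Lim_null_comparison[OF always_eventually LIMSEQ_inverse_real_of_nat]) (use Aw in blast)
    then have "(\<lambda>n. A (w n)) \<longlonglongrightarrow> A u" by (simp add: LIM_zero_iff)
    from LIMSEQ_subseq_LIMSEQ[OF this r] have "(\<lambda>n. A ((w \<circ> r) n)) \<longlonglongrightarrow> A u" by (simp add: o_def)
    moreover have "\<forall>n. (w \<circ> r) n \<in> D" using w K(2) by auto
    ultimately have "l \<in> D \<and> A l = A u"
      using closed l unfolding closed_operator_def by blast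
    then have "l = u" using inj u by (auto dest: inj_onD)
    have "(\<lambda>n. norm ((w \<circ> r) n - u)) \<longlonglongrightarrow> norm (l - u)"
      using l by (intro tendsto_intros)
    then have "e \<le> norm (l - u)" by (rule LIMSEQ_le_const) (use far in auto)
    with \<open>l = u\<close> e show False by simp
  qed
  then show thesis using that by blast
qed

theorem theorem3p1:
  fixes A :: "'x::banach \<Rightarrow> 'y::banach"
    and DA D\<phi> :: "'x set"
    and \<phi> :: "'x \<Rightarrow> real"
    and g :: 'y and u :: 'x and c :: real
    and gd :: "real \<Rightarrow> 'y"
    and R :: "real \<Rightarrow> 'y \<Rightarrow> 'x"
  assumes "closed_operator DA A"
    and "inj_on A DA"
    and "g \<in> A ` DA"
    and "u \<in> DA" and "A u = g"
    and "D\<phi> \<subseteq> DA"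
    and "\<And>v. v \<in> D\<phi> \<Longrightarrow> 0 \<le> \<phi> v"
    and "\<And>v. v \<in> D\<phi> \<Longrightarrow> v \<noteq> 0 \<Longrightarrow> 0 < \<phi> v"
    and "\<And>b. 0 < b \<Longrightarrow> compact (sublevel_set D\<phi> \<phi> b)"
    and "\<And>b w v. 0 < b \<Longrightarrow> (\<And>n. w n \<in> sublevel_set D\<phi> \<phi> b) \<Longrightarrow> w \<longlonglongrightarrow> v \<Longrightarrow>
           ereal (\<phi> v) \<le> liminf (\<lambda>n. ereal (\<phi> (w n)))"
    and "u \<in> D\<phi>"
    and "0 < c" and "\<phi> u \<le> c"
    and "\<And>\<delta>. 0 < \<delta> \<Longrightarrow> norm (gd \<delta> - g) \<le> \<delta>"
    and "\<And>\<delta>. 0 < \<delta> \<Longrightarrow>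
           minimizing_limit (penalized_functional A \<phi> \<delta> (gd \<delta>))
             (admissible_set A (sublevel_set D\<phi> \<phi> c) \<delta> (gd \<delta>)) (R \<delta> (gd \<delta>))"
  shows "regularizer_new_sense A (sublevel_set D\<phi> \<phi> c) gd R"
proof -
  define K where "K = sublevel_set D\<phi> \<phi> c"
  define S where "S = (\<lambda>\<delta>. admissible_set A K \<delta> (gd \<delta>))"
  define \<rho> where "\<rho> = (\<lambda>\<delta>. SUP v\<in>S \<delta>. norm (v - u))"
  have "compact K" unfolding K_def using assms(9,12) by blast
  have "K \<subseteq> DA" unfolding K_def sublevel_set_def using assms(6) by auto
  have S_sub: "S \<delta> \<subseteq> K" for \<delta> by (auto simp: S_def admissible_set_def)
  have R_limit: "\<exists>w. (\<forall>n. w n \<in> S \<delta>) \<and> w \<longlonglongrightarrow> R \<delta> (gd \<delta>)" if \<delta>: "0 < \<delta>" for \<delta>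
  proof -
    obtain w r where "minimizing_sequence (penalized_functional A \<phi> \<delta> (gd \<delta>)) (S \<delta>) w"
      and lim: "(w \<circ> r) \<longlonglongrightarrow> R \<delta> (gd \<delta>)"
      using assms(15)[OF \<delta>] unfolding minimizing_limit_def S_def K_def by blast
    then have "\<forall>n. (w \<circ> r) n \<in> S \<delta>" by (auto simp: minimizing_sequence_def)
    with lim show ?thesis by blast
  qed
  have S_nonempty: "S \<delta> \<noteq> {}" if "0 < \<delta>" for \<delta> using R_limit[OF that] by auto
  obtain B where B: "\<And>v. v \<in> K \<Longrightarrow> norm (v - u) \<le> B"
    using compact_imp_bounded[OF \<open>compact K\<close>] unfolding bounded_any_center[where a = u]
    by (metis dist_commute dist_norm)
  have bdd: "bdd_above ((\<lambda>v. norm (v - u)) ` S \<delta>)" for \<delta>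
    using B S_sub[of \<delta>] by (intro bdd_aboveI2[where M = B]) auto
  have S_le: "norm (v - u) \<le> \<rho> \<delta>" if "v \<in> S \<delta>" for v \<delta>
    unfolding \<rho>_def by (rule cSUP_upper[OF that bdd])
  have R_le: "norm (R \<delta> (gd \<delta>) - u) \<le> \<rho> \<delta>" if \<delta>: "0 < \<delta>" for \<delta>
  proof -
    obtain w where w: "\<forall>n. w n \<in> S \<delta>" and "w \<longlonglongrightarrow> R \<delta> (gd \<delta>)" using R_limit[OF \<delta>] by blast
    then have "(\<lambda>n. norm (w n - u)) \<longlonglongrightarrow> norm (R \<delta> (gd \<delta>) - u)" by (intro tendsto_intros)
    then show ?thesis by (rule LIMSEQ_le_const2) (use w S_le in auto)
  qed
  have "(\<rho> \<longlongrightarrow> 0) (at_right 0)"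
  proof (rule tendstoI)
    fix e :: real assume "0 < e"
    obtain d where "0 < d"
      and d: "\<And>v. v \<in> K \<Longrightarrow> norm (A v - A u) \<le> d \<Longrightarrow> norm (v - u) < e / 2"
      using inverse_of_closed_injective_continuous_at[OF assms(1,2) \<open>compact K\<close> \<open>K \<subseteq> DA\<close> assms(4)]
        \<open>0 < e\<close> by (metis half_gt_zero)
    have "dist (\<rho> \<delta>) 0 < e" if \<delta>: "0 < \<delta>" "\<delta> < d / 2" for \<delta>
    proof -
      have "norm (v - u) \<le> e / 2" if v: "v \<in> S \<delta>" for v
      proof -
        have "norm (A v - gd \<delta>) \<le> \<delta>" using v by (simp add: S_def admissible_set_def)
        with assms(14)[OF \<delta>(1)] \<delta>(2) assms(5) have "norm (A v - A u) \<le> d"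
          using norm_triangle_ineq[of "A v - gd \<delta>" "gd \<delta> - g"] by simp
        then show ?thesis using d[of v] v S_sub by fastforce
      qed
      then have "\<rho> \<delta> \<le> e / 2" unfolding \<rho>_def by (intro cSUP_least S_nonempty \<delta>(1))
      moreover have "0 \<le> \<rho> \<delta>" using R_le[OF \<delta>(1)] norm_ge_zero order_trans by blast
      ultimately show ?thesis using \<open>0 < e\<close> by simp
    qed
    then show "\<forall>\<^sub>F \<delta> in at_right 0. dist (\<rho> \<delta>) 0 < e"
      using \<open>0 < d\<close> by (auto simp: eventually_at_right_field intro!: exI[of _ "d / 2"])
  qed
  then have "((\<lambda>\<delta>. 2 * \<rho> \<delta>) \<longlongrightarrow> 0) (at_right 0)" by (rule tendsto_mult_right_zero)
  moreover have "(SUP v\<in>S \<delta>. ereal (norm (R \<delta> (gd \<delta>) - v))) \<le> ereal (2 * \<rho> \<delta>)"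
    if "0 < \<delta>" for \<delta>
  proof (rule SUP_least)
    fix v assume "v \<in> S \<delta>"
    with R_le[OF that] S_le have "norm (R \<delta> (gd \<delta>) - u) + norm (v - u) \<le> 2 * \<rho> \<delta>" by fastforce
    with norm_triangle_ineq4[of "R \<delta> (gd \<delta>) - u" "v - u"]
    show "ereal (norm (R \<delta> (gd \<delta>) - v)) \<le> ereal (2 * \<rho> \<delta>)" by simp
  qed
  ultimately show ?thesis
    unfolding regularizer_new_sense_def S_def K_def
    by (intro exI[of _ "\<lambda>\<delta>. 2 * \<rho> \<delta>"]) auto
qed

end
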